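(* Let $\omega\neq 0$ be real and $\Delta t>0$ with $\sin(\omega\Delta t)\neq 0$, and let $$\alpha=\frac{\omega\Delta t\,(1+\cos(\omega\Delta t))}{2\sin(\omega\Delta t)}.$$ Let $\widetilde H$ be a discrete local energy of the form described in the context, let $\widetilde{\mathcal H}(\mathbf Z)=\Delta x\sum_m\widetilde H(\mathbf Z)_m$ be the associated semidiscrete global energy, and let $\mathbf z_n,\mathbf z_{n+1}$ be complex grid functions satisfying the exponentially fitted discrete variational derivative (EF DVD) method $$\alpha\,\delta_n^+z_{m,n}=-\mathrm i\,\mathcal F(\mathbf z_n,\mathbf z_{n+1})_m\qquad\text{for all } m .$$ Assume that the boundary conditions are suitable, such as periodic, i.e. such that the boundary terms arising in the summations by parts in space described in the context vanish. Then $$\widetilde{\mathcal H}(\mathbf z_{n+1})=\widetilde{\mathcal H}(\mathbf z_n).$$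
   Context: Setting: complex Hamiltonian PDEs $z_t=-\mathrm i\,\delta\mathcal H/\delta z^*$ on $(a,b)\times(0,T)$, where $*$ is complex conjugation, $\mathcal H=\int H(z,z_x)\,\mathrm dx$ and $H(z,z_x)=\sum_\ell|f_\ell(z)|^{p_\ell}|g_\ell(z_x)|^{q_\ell}$ (finite sum). Grid and operators: uniform spatial grid $x_m$ of step $\Delta x>0$, times $t_n=n\Delta t$; $\mathbf z_n$ is the vector with entries $z_{m,n}\in\mathbb C$ approximating $z(x_m,t_n)$. Put $\delta_m^+Z_m=(Z_{m+1}-Z_m)/\Delta x$, $\delta_m^-Z_m=(Z_m-Z_{m-1})/\Delta x$, $\delta_n^+z_{m,n}=(z_{m,n+1}-z_{m,n})/\Delta t$. Discrete local energy: $$\widetilde H(\mathbf Z)_m=\sum_\ell P_\ell(Z_m)Q_\ell^+(Z_m)Q_\ell^-(Z_m),$$ $$P_\ell(Z_m)=|f_\ell(Z_m)|^{p_\ell},\quad Q_\ell^+(Z_m)=|g_\ell^+(\delta_m^+Z_m)|^{q_\ell^+},\quad Q_\ell^-(Z_m)=|g_\ell^-(\delta_m^-Z_m)|^{q_\ell^-},$$ where $f_\ell,g_\ell^+,g_\ell^-$ are analytic functions and $p_\ell,q_\ell^+,q_\ell^-\in\{2,3,\dots\}$. Discrete variational derivative, for grid functions $\mathbf a,\mathbf b$ with entries $\mathbf a_m,\mathbf b_m$: $$\left(\frac{\delta\widetilde H}{\delta(\mathbf a,\mathbf b)}\right)_m=\left(\frac{\partial\widetilde H}{\partial(\mathbf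 a,\mathbf b)}\right)_m-\delta_m^-\left(\frac{\partial\widetilde H}{\partial\delta^+(\mathbf a,\mathbf b)}\right)_m-\delta_m^+\left(\frac{\partial\widetilde H}{\partial\delta^-(\mathbf a,\mathbf b)}\right)_m,$$ where $$\left(\frac{\partial\widetilde H}{\partial(\mathbf a,\mathbf b)}\right)_m=\sum_\ell\frac{Q_\ell^+(\mathbf a_m)Q_\ell^-(\mathbf a_m)+Q_\ell^+(\mathbf b_m)Q_\ell^-(\mathbf b_m)}2\cdot\frac{f_\ell(\mathbf a_m)-f_\ell(\mathbf b_m)}{\mathbf a_m-\mathbf b_m}\,\rho(p_\ell;f_\ell(\mathbf a_m),f_\ell(\mathbf b_m)),$$ $$\left(\frac{\partial\widetilde H}{\partial\delta^+(\mathbf a,\mathbf b)}\right)_m=\sum_\ell\frac{P_\ell(\mathbf a_m)+P_\ell(\mathbf b_m)}2\cdot\frac{Q_\ell^-(\mathbf a_m)+Q_\ell^-(\mathbf b_m)}2\cdot\frac{g_\ell^+(\delta_m^+\mathbf a_m)-g_\ell^+(\delta_m^+\mathbf b_m)}{\delta_m^+\mathbf a_m-\delta_m^+\mathbf b_m}\,\rho(q_\ell^+;g_\ell^+(\delta_m^+\mathbf a_m),g_\ell^+(\delta_m^+\mathbf b_m)),$$ $$\left(\frac{\partial\widetilde H}{\partial\delta^-(\mathbf a,\mathbf b)}\right)_m=\sum_\ell\frac{P_\ell(\mathbf a_m)+P_\ell(\mathbf b_m)}2\cdot\frac{Q_\ell^+(\mathbf a_m)+Q_\ell^+(\mathbf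 b_m)}2\cdot\frac{g_\ell^-(\delta_m^-\mathbf a_m)-g_\ell^-(\delta_m^-\mathbf b_m)}{\delta_m^-\mathbf a_m-\delta_m^-\mathbf b_m}\,\rho(q_\ell^-;g_\ell^-(\delta_m^-\mathbf a_m),g_\ell^-(\delta_m^-\mathbf b_m)).$$ Difference quotients with vanishing denominator are read as the derivative of the analytic function. Here, for $s_1,s_2\in\mathbb C$ and an integer $k\ge2$, $$\rho(k;s_1,s_2)=\frac{s_1^*+s_2^*}2\left(|s_1|^{k-2}+|s_1|^{k-4}|s_2|^2+\dots+|s_2|^{k-2}\right)\quad(k\text{ even}),$$ $$\rho(k;s_1,s_2)=\frac{s_1^*+s_2^*}2\cdot\frac{|s_1|^{k-1}+|s_1|^{k-2}|s_2|+\dots+|s_2|^{k-1}}{|s_1|+|s_2|}\quad(k\text{ odd}),$$ with value $0$ if $s_1=s_2=0$ and $k$ is odd. The function $\mathcal F$ is $$\mathcal F(\mathbf z_n,\mathbf z_{n+1})_m=\left(\frac{\delta\widetilde H}{\delta(\mathbf z_{n+1}^*,\mathbf z_n^* )}\right)_m,\qquad\text{with the convention}\qquad \left(\frac{\delta\widetilde H}{\delta(\mathbf a^*,\mathbf b^* )}\right)_m=\left(\frac{\delta\widetilde H}{\delta(\mathbf a,\mathbf b)}\right)_m^{*}.$$ Boundary conditions: suitable means that, with $w_m=z_{m,n+1}-z_{m,n}$, $A_m=\left(\frac{\partial\widetilde H}{\partial\delta^+(\mathbf z_{n+1},\mathbf z_n)}\right)_m$ and $B_m=\left(\frac{\partial\widetilde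 H}{\partial\delta^-(\mathbf z_{n+1},\mathbf z_n)}\right)_m$, one has $\sum_mA_m\,\delta_m^+w_m=-\sum_m(\delta_m^-A_m)w_m$ and $\sum_mB_m\,\delta_m^-w_m=-\sum_m(\delta_m^+B_m)w_m$. This holds in particular for periodic boundary conditions, with all sums over $m$ (including that in $\widetilde{\mathcal H}$) taken over one period. *)

theory Defs
  imports "HOL-Complex_Analysis.Complex_Analysis"
begin

text \<open>Grid functions are modelled as functions on all of \<open>\<int>\<close>, so that the stencils are defined
  at every node; the nodes over which spatial sums are taken form a finite set \<open>M\<close>, and the
  values outside \<open>M\<close> are those prescribed by the boundary conditions (periodic continuation,
  ghost values).\<close>

type_synonym grid_fun = "int \<Rightarrow> complex"

definition fwd_diff :: "real \<Rightarrow> grid_fun \<Rightarrow> grid_fun" where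
  "fwd_diff dx Z m = (Z (m + 1) - Z m) / of_real dx"

definition bwd_diff :: "real \<Rightarrow> grid_fun \<Rightarrow> grid_fun" where
  "bwd_diff dx Z m = (Z m - Z (m - 1)) / of_real dx"

definition time_diff :: "real \<Rightarrow> (nat \<Rightarrow> grid_fun) \<Rightarrow> nat \<Rightarrow> grid_fun" where
  "time_diff dt z n m = (z (Suc n) m - z n m) / of_real dt"


subsection \<open>Discrete local energies\<close>

record energy_term =
  f_fun :: "complex \<Rightarrow> complex"
  p_exp :: nat
  gp_fun :: "complex \<Rightarrow> complex"
  qp_exp :: nat
  gm_fun :: "complex \<Rightarrow> complex"
  qm_exp :: nat

definition valid_term :: "energy_term \<Rightarrow> bool" where
  "valid_term t \<longleftrightarrow>
     f_fun t analytic_on UNIV \<and> gp_fun t analytic_on UNIV \<and> gm_fun t analytic_on UNIV \<and>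
     p_exp t \<ge> 2 \<and> qp_exp t \<ge> 2 \<and> qm_exp t \<ge> 2"

definition P_fac :: "energy_term \<Rightarrow> grid_fun \<Rightarrow> int \<Rightarrow> real" where
  "P_fac t Z m = norm (f_fun t (Z m)) ^ p_exp t"

definition Qp_fac :: "real \<Rightarrow> energy_term \<Rightarrow> grid_fun \<Rightarrow> int \<Rightarrow> real" where
  "Qp_fac dx t Z m = norm (gp_fun t (fwd_diff dx Z m)) ^ qp_exp t"

definition Qm_fac :: "real \<Rightarrow> energy_term \<Rightarrow> grid_fun \<Rightarrow> int \<Rightarrow> real" where
  "Qm_fac dx t Z m = norm (gm_fun t (bwd_diff dx Z m)) ^ qm_exp t"

definition local_energy ::
    "real \<Rightarrow> 'l set \<Rightarrow> ('l \<Rightarrow> energy_term) \<Rightarrow> grid_fun \<Rightarrow> int \<Rightarrow> real" where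
  "local_energy dx L T Z m = (\<Sum>l\<in>L. P_fac (T l) Z m * Qp_fac dx (T l) Z m * Qm_fac dx (T l) Z m)"

definition global_energy ::
    "real \<Rightarrow> 'l set \<Rightarrow> ('l \<Rightarrow> energy_term) \<Rightarrow> int set \<Rightarrow> grid_fun \<Rightarrow> real" where
  "global_energy dx L T M Z = dx * (\<Sum>m\<in>M. local_energy dx L T Z m)"


subsection \<open>Discrete variational derivative\<close>

definition diff_quot :: "(complex \<Rightarrow> complex) \<Rightarrow> complex \<Rightarrow> complex \<Rightarrow> complex" where
  "diff_quot f x y = (if x = y then deriv f x else (f x - f y) / (x - y))"

definition rho :: "nat \<Rightarrow> complex \<Rightarrow> complex \<Rightarrow> complex" where
  "rho k s1 s2 =
     (if even k then
        (cnj s1 + cnj s2) / 2 *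
          of_real (\<Sum>j = 0..(k - 2) div 2. norm s1 ^ (k - 2 - 2 * j) * norm s2 ^ (2 * j))
      else if s1 = 0 \<and> s2 = 0 then 0
      else
        (cnj s1 + cnj s2) / 2 *
          of_real ((\<Sum>j = 0..k - 1. norm s1 ^ (k - 1 - j) * norm s2 ^ j) / (norm s1 + norm s2)))"

definition dH :: "real \<Rightarrow> 'l set \<Rightarrow> ('l \<Rightarrow> energy_term) \<Rightarrow> grid_fun \<Rightarrow> grid_fun \<Rightarrow> grid_fun" where
  "dH dx L T a b m =
     (\<Sum>l\<in>L. of_real ((Qp_fac dx (T l) a m * Qm_fac dx (T l) a m
                     + Qp_fac dx (T l) b m * Qm_fac dx (T l) b m) / 2)
        * diff_quot (f_fun (T l)) (a m) (b m)
        * rho (p_exp (T l)) (f_fun (T l) (a m)) (f_fun (T l) (b m)))"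

definition dH_fwd :: "real \<Rightarrow> 'l set \<Rightarrow> ('l \<Rightarrow> energy_term) \<Rightarrow> grid_fun \<Rightarrow> grid_fun \<Rightarrow> grid_fun" where
  "dH_fwd dx L T a b m =
     (\<Sum>l\<in>L. of_real ((P_fac (T l) a m + P_fac (T l) b m) / 2
                  * ((Qm_fac dx (T l) a m + Qm_fac dx (T l) b m) / 2))
        * diff_quot (gp_fun (T l)) (fwd_diff dx a m) (fwd_diff dx b m)
        * rho (qp_exp (T l)) (gp_fun (T l) (fwd_diff dx a m)) (gp_fun (T l) (fwd_diff dx b m)))"

definition dH_bwd :: "real \<Rightarrow> 'l set \<Rightarrow> ('l \<Rightarrow> energy_term) \<Rightarrow> grid_fun \<Rightarrow> grid_fun \<Rightarrow> grid_fun" where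
  "dH_bwd dx L T a b m =
     (\<Sum>l\<in>L. of_real ((P_fac (T l) a m + P_fac (T l) b m) / 2
                  * ((Qp_fac dx (T l) a m + Qp_fac dx (T l) b m) / 2))
        * diff_quot (gm_fun (T l)) (bwd_diff dx a m) (bwd_diff dx b m)
        * rho (qm_exp (T l)) (gm_fun (T l) (bwd_diff dx a m)) (gm_fun (T l) (bwd_diff dx b m)))"

definition var_deriv ::
    "real \<Rightarrow> 'l set \<Rightarrow> ('l \<Rightarrow> energy_term) \<Rightarrow> grid_fun \<Rightarrow> grid_fun \<Rightarrow> grid_fun" where
  "var_deriv dx L T a b m =
     dH dx L T a b m - bwd_diff dx (dH_fwd dx L T a b) m - fwd_diff dx (dH_bwd dx L T a b) m"

text \<open>The derivative with respect to the conjugated pair \<open>(a\<^sup>*, b\<^sup>*)\<close> is by convention the conjugate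
  of the derivative with respect to \<open>(a, b)\<close>. It is not \<^const>\<open>var_deriv\<close> evaluated at the
  conjugated grid functions, so \<open>a\<close> and \<open>b\<close> are passed unconjugated.\<close>

definition var_deriv_conj ::
    "real \<Rightarrow> 'l set \<Rightarrow> ('l \<Rightarrow> energy_term) \<Rightarrow> grid_fun \<Rightarrow> grid_fun \<Rightarrow> grid_fun" where
  "var_deriv_conj dx L T a b m = cnj (var_deriv dx L T a b m)"

definition F_dvd ::
    "real \<Rightarrow> 'l set \<Rightarrow> ('l \<Rightarrow> energy_term) \<Rightarrow> grid_fun \<Rightarrow> grid_fun \<Rightarrow> grid_fun" where
  "F_dvd dx L T z_old z_new m = var_deriv_conj dx L T z_new z_old m"


subsection \<open>The exponentially fitted scheme\<close>

definition ef_alpha :: "real \<Rightarrow> real \<Rightarrow> real" where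
  "ef_alpha \<omega> dt = \<omega> * dt * (1 + cos (\<omega> * dt)) / (2 * sin (\<omega> * dt))"

definition ef_dvd_step ::
    "real \<Rightarrow> real \<Rightarrow> real \<Rightarrow> 'l set \<Rightarrow> ('l \<Rightarrow> energy_term) \<Rightarrow> int set \<Rightarrow> (nat \<Rightarrow> grid_fun) \<Rightarrow> nat \<Rightarrow> bool"
  where
  "ef_dvd_step \<omega> dt dx L T M z n \<longleftrightarrow>
     (\<forall>m\<in>M. of_real (ef_alpha \<omega> dt) * time_diff dt z n m
            = - \<i> * F_dvd dx L T (z n) (z (Suc n)) m)"


subsection \<open>Boundary conditions\<close>

definition suitable_bc ::
    "real \<Rightarrow> 'l set \<Rightarrow> ('l \<Rightarrow> energy_term) \<Rightarrow> int set \<Rightarrow> grid_fun \<Rightarrow> grid_fun \<Rightarrow> bool" where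
  "suitable_bc dx L T M z_old z_new \<longleftrightarrow>
     (let w = (\<lambda>m. z_new m - z_old m);
          A = dH_fwd dx L T z_new z_old;
          B = dH_bwd dx L T z_new z_old
      in (\<Sum>m\<in>M. A m * fwd_diff dx w m) = - (\<Sum>m\<in>M. bwd_diff dx A m * w m) \<and>
         (\<Sum>m\<in>M. B m * bwd_diff dx w m) = - (\<Sum>m\<in>M. fwd_diff dx B m * w m))"

definition periodic_grid_fun :: "nat \<Rightarrow> grid_fun \<Rightarrow> bool" where
  "periodic_grid_fun N Z \<longleftrightarrow> (\<forall>m. Z (m + int N) = Z m)"

lemma sum_period_shift:
  fixes F :: grid_fun
  assumes "periodic_grid_fun N F"
  shows "(\<Sum>m\<in>{k..<k + int N}. F (m + 1)) = (\<Sum>m\<in>{k..<k + int N}. F m)"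
proof (cases "N = 0")
  case False
  have "(\<Sum>m\<in>{k..<k + int N}. F (m + 1)) = (\<Sum>m\<in>{k + 1..<k + int N + 1}. F m)"
    by (rule sum.reindex_bij_witness[of _ "\<lambda>m. m - 1" "\<lambda>m. m + 1"]) auto
  also have "{k + 1..<k + int N + 1} = insert (k + int N) {k + 1..<k + int N}"
    using False by auto
  also have "(\<Sum>m\<in>\<dots>. F m) = F k + (\<Sum>m\<in>{k + 1..<k + int N}. F m)"
    using assms by (simp add: periodic_grid_fun_def)
  also have "\<dots> = (\<Sum>m\<in>insert k {k + 1..<k + int N}. F m)"
    by simp
  also have "insert k {k + 1..<k + int N} = {k..<k + int N}"
    using False by auto
  finally show ?thesis .
qed simp

lemma periodic_summation_by_parts:
  assumes "periodic_grid_fun N u" "periodic_grid_fun N v"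
  shows "(\<Sum>m\<in>{k..<k + int N}. u m * fwd_diff dx v m)
       = - (\<Sum>m\<in>{k..<k + int N}. bwd_diff dx u m * v m)"
proof -
  let ?M = "{k..<k + int N}"
  have "periodic_grid_fun N (\<lambda>m. u (m - 1) * v m)"
    using assms unfolding periodic_grid_fun_def
    by (metis add_diff_eq diff_add_eq)
  from sum_period_shift[OF this, of k]
  have "(\<Sum>m\<in>?M. u m * v (m + 1)) = (\<Sum>m\<in>?M. u (m - 1) * v m)" by simp
  then have "(\<Sum>m\<in>?M. u m * (v (m + 1) - v m)) = - (\<Sum>m\<in>?M. (u m - u (m - 1)) * v m)"
    by (simp add: algebra_simps sum_subtractf)
  then show ?thesis
    by (simp add: fwd_diff_def bwd_diff_def flip: sum_divide_distrib)
qed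

lemma periodic_fwd_diff: "periodic_grid_fun N Z \<Longrightarrow> fwd_diff dx Z (m + int N) = fwd_diff dx Z m"
  unfolding periodic_grid_fun_def fwd_diff_def by (metis add.commute add.left_commute)

lemma periodic_bwd_diff: "periodic_grid_fun N Z \<Longrightarrow> bwd_diff dx Z (m + int N) = bwd_diff dx Z m"
  unfolding periodic_grid_fun_def bwd_diff_def by (metis add_diff_eq diff_add_eq)

lemma periodic_suitable_bc:
  assumes "periodic_grid_fun N z_old" "periodic_grid_fun N z_new"
  shows "suitable_bc dx L T {k..<k + int N} z_old z_new"
proof -
  let ?M = "{k..<k + int N}"
  let ?A = "dH_fwd dx L T z_new z_old" and ?B = "dH_bwd dx L T z_new z_old"
  let ?w = "\<lambda>m. z_new m - z_old m"
  have z: "z_old (m + int N) = z_old m" "z_new (m + int N) = z_new m" for m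
    using assms by (auto simp: periodic_grid_fun_def)
  have A: "periodic_grid_fun N ?A" and B: "periodic_grid_fun N ?B"
    unfolding periodic_grid_fun_def dH_fwd_def dH_bwd_def P_fac_def Qp_fac_def Qm_fac_def
    by (simp_all add: z periodic_fwd_diff periodic_bwd_diff assms)
  have w: "periodic_grid_fun N ?w"
    by (simp add: periodic_grid_fun_def z)
  show ?thesis
    unfolding suitable_bc_def Let_def
    using periodic_summation_by_parts[OF A w, where k = k and dx = dx]
          periodic_summation_by_parts[OF w B, where k = k and dx = dx]
    by (simp add: mult.commute)
qed

end

theory Submission
  imports Defs
begin

text \<open>
  One step of the scheme changes the energy by \<open>2 \<Delta>x Re (\<Sum>\<^sub>m V\<^sub>m w\<^sub>m)\<close>, where \<open>w\<close> is the increment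
  of the solution and \<open>V\<close> the discrete variational derivative: this is an \<^emph>\<open>exact\<close> discrete chain
  rule (\<open>local_energy_difference\<close>) followed by summation by parts. Since \<open>\<alpha>\<close> is a nonzero real
  number (\<open>ef_alpha_nonzero\<close>), the scheme says that \<open>w\<^sub>m\<close> is an imaginary multiple of the
  conjugate of \<open>V\<^sub>m\<close>. Each \<open>V\<^sub>m w\<^sub>m\<close> is then purely imaginary, and no energy is gained or lost.

  Exactness of the chain rule has two sources. The function \<open>\<rho>\<close> is built such that
  \<open>Re ((s\<^sub>1 - s\<^sub>2) \<rho>(k; s\<^sub>1, s\<^sub>2))\<close> is half the difference \<open>\<bar>s\<^sub>1\<bar>\<^sup>k - \<bar>s\<^sub>2\<bar>\<^sup>k\<close> (\<open>Re_diff_mult_rho\<close>), and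
  the averaged weights are those of the product rule
  \<open>u\<^sub>1 v\<^sub>1 - u\<^sub>2 v\<^sub>2 = (v\<^sub>1 + v\<^sub>2)/2 (u\<^sub>1 - u\<^sub>2) + (u\<^sub>1 + u\<^sub>2)/2 (v\<^sub>1 - v\<^sub>2)\<close>, applied twice to \<open>P Q\<^sup>+ Q\<^sup>-\<close>.
\<close>

lemma power_diff_sum_0_to_pred:
  fixes a b :: "'a :: comm_ring_1"
  shows "(a - b) * (\<Sum>j = 0..k. a ^ (k - j) * b ^ j) = a ^ Suc k - b ^ Suc k"
proof -
  have "(\<Sum>j = 0..k. a ^ (k - j) * b ^ j) = (\<Sum>j<Suc k. b ^ j * a ^ (k - j))"
    by (simp add: atLeast0AtMost lessThan_Suc_atMost mult.commute)
  then show ?thesis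
    using diff_power_eq_sum[of b k a] by (simp add: algebra_simps)
qed

text \<open>Up to an imaginary part, \<open>(s\<^sub>1 - s\<^sub>2) (s\<^sub>1\<^sup>* + s\<^sub>2\<^sup>*)\<close> is \<open>\<bar>s\<^sub>1\<bar>\<^sup>2 - \<bar>s\<^sub>2\<bar>\<^sup>2\<close>. The real factor of \<open>\<rho>\<close> is the
  geometric sum that completes this to a difference of \<open>k\<close>-th powers: a sum in the squares
  for even \<open>k\<close>, and for odd \<open>k\<close> one in the moduli, after \<open>\<bar>s\<^sub>1\<bar> + \<bar>s\<^sub>2\<bar>\<close> has been cancelled.\<close>

lemma Re_diff_mult_rho:
  assumes "k \<ge> 2"
  shows "Re ((s1 - s2) * rho k s1 s2) = (norm s1 ^ k - norm s2 ^ k) / 2"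
proof -
  let ?a = "norm s1" and ?b = "norm s2"
  have sq: "Re ((s1 - s2) * ((cnj s1 + cnj s2) / 2 * of_real c)) = (?a\<^sup>2 - ?b\<^sup>2) / 2 * c" for c
    unfolding cmod_power2 by (simp add: field_simps power2_eq_square)
  show ?thesis
  proof (cases "even k")
    case True
    then obtain i where i: "k = 2 * i"
      by (rule evenE)
    define j where "j = i - 1"
    have k: "k = 2 * Suc j"
      using assms i by (simp add: j_def)
    have "(\<Sum>i = 0..(k - 2) div 2. ?a ^ (k - 2 - 2 * i) * ?b ^ (2 * i))
        = (\<Sum>i = 0..j. (?a\<^sup>2) ^ (j - i) * (?b\<^sup>2) ^ i)"
      by (simp add: k flip: power_mult diff_mult_distrib2)
    then have "Re ((s1 - s2) * rho k s1 s2)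
        = (?a\<^sup>2 - ?b\<^sup>2) / 2 * (\<Sum>i = 0..j. (?a\<^sup>2) ^ (j - i) * (?b\<^sup>2) ^ i)"
      using True by (simp only: rho_def if_True sq)
    also have "\<dots> = ((?a\<^sup>2) ^ Suc j - (?b\<^sup>2) ^ Suc j) / 2"
      unfolding power_diff_sum_0_to_pred[symmetric] by simp
    also have "\<dots> = (?a ^ k - ?b ^ k) / 2"
      by (simp only: k power_mult)
    finally show ?thesis .
  next
    case False
    show ?thesis
    proof (cases "s1 = 0 \<and> s2 = 0")
      case True
      then show ?thesis using assms by simp
    next
      case nz: False
      then have pos: "?a + ?b > 0"
        by (cases "s1 = 0") (simp_all add: add_pos_nonneg)
      let ?S = "\<Sum>j = 0..k - 1. ?a ^ (k - 1 - j) * ?b ^ j"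
      have "Re ((s1 - s2) * rho k s1 s2) = (?a\<^sup>2 - ?b\<^sup>2) / 2 * (?S / (?a + ?b))"
        using False nz by (simp only: rho_def if_False sq)
      also have "\<dots> = (?a - ?b) * ?S / 2"
        unfolding power2_eq_square square_diff_square_factored using pos
        by (simp add: nonzero_divide_eq_eq nonzero_eq_divide_eq)
      also have "\<dots> = (?a ^ k - ?b ^ k) / 2"
        using assms by (simp only: power_diff_sum_0_to_pred) simp
      finally show ?thesis .
    qed
  qed
qed

text \<open>When the arguments coincide, both sides vanish whatever value the quotient is given.\<close>

lemma diff_quot_mult_diff: "diff_quot f x y * (x - y) = f x - f y"
  by (simp add: diff_quot_def)

lemma Re_diff_quot_rho:
  assumes "k \<ge> 2"
  shows "Re (of_real c * diff_quot f x y * rho k (f x) (f y) * (x - y))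
       = c * ((norm (f x) ^ k - norm (f y) ^ k) / 2)"
proof -
  have "of_real c * diff_quot f x y * rho k (f x) (f y) * (x - y)
      = of_real c * ((diff_quot f x y * (x - y)) * rho k (f x) (f y))"
    by (simp add: mult_ac)
  also have "Re \<dots> = c * Re ((f x - f y) * rho k (f x) (f y))"
    by (simp only: diff_quot_mult_diff times_complex.sel) simp
  finally show ?thesis
    by (simp only: Re_diff_mult_rho[OF assms])
qed

text \<open>The weights are averages, so the three partial increments of \<open>P Q\<^sup>+ Q\<^sup>-\<close> add up to its total
  increment without remainder. The factor \<open>2\<close> undoes the halving in \<open>Re_diff_mult_rho\<close>; it stands
  for the sum of the derivatives in \<open>z\<close> and in \<open>z\<^sup>*\<close>, which are conjugate to each other.\<close>

lemma local_energy_difference: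
  assumes "\<And>l. l \<in> L \<Longrightarrow> valid_term (T l)"
  shows "local_energy dx L T a m - local_energy dx L T b m
       = 2 * Re (dH dx L T a b m * (a m - b m)
               + dH_fwd dx L T a b m * (fwd_diff dx a m - fwd_diff dx b m)
               + dH_bwd dx L T a b m * (bwd_diff dx a m - bwd_diff dx b m))"
proof -
  let ?P = "\<lambda>l Z. P_fac (T l) Z m"
  let ?Q = "\<lambda>l Z. Qp_fac dx (T l) Z m"
  let ?R = "\<lambda>l Z. Qm_fac dx (T l) Z m"
  have k: "p_exp (T l) \<ge> 2" "qp_exp (T l) \<ge> 2" "qm_exp (T l) \<ge> 2" if "l \<in> L" for l
    using assms[OF that] by (auto simp: valid_term_def)
  have P: "Re (dH dx L T a b m * (a m - b m))
      = (\<Sum>l\<in>L. (?Q l a * ?R l a + ?Q l b * ?R l b) / 2 * ((?P l a - ?P l b) / 2))"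
    unfolding dH_def sum_distrib_right Re_sum
    by (rule sum.cong[OF refl]) (simp only: Re_diff_quot_rho[OF k(1)] P_fac_def)
  have Q: "Re (dH_fwd dx L T a b m * (fwd_diff dx a m - fwd_diff dx b m))
      = (\<Sum>l\<in>L. (?P l a + ?P l b) / 2 * ((?R l a + ?R l b) / 2) * ((?Q l a - ?Q l b) / 2))"
    unfolding dH_fwd_def sum_distrib_right Re_sum
    by (rule sum.cong[OF refl]) (simp only: Re_diff_quot_rho[OF k(2)] Qp_fac_def)
  have R: "Re (dH_bwd dx L T a b m * (bwd_diff dx a m - bwd_diff dx b m))
      = (\<Sum>l\<in>L. (?P l a + ?P l b) / 2 * ((?Q l a + ?Q l b) / 2) * ((?R l a - ?R l b) / 2))"
    unfolding dH_bwd_def sum_distrib_right Re_sum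
    by (rule sum.cong[OF refl]) (simp only: Re_diff_quot_rho[OF k(3)] Qm_fac_def)
  show ?thesis
    unfolding local_energy_def plus_complex.sel P Q R
    unfolding sum.distrib[symmetric] sum_subtractf[symmetric] sum_distrib_left
    by (rule sum.cong[OF refl]) (simp add: field_simps)
qed

text \<open>Summation by parts moves the spatial differences from the increment onto the partial
  derivatives, which assembles the variational derivative.\<close>

lemma global_energy_difference:
  assumes "\<And>l. l \<in> L \<Longrightarrow> valid_term (T l)" and "suitable_bc dx L T M b a"
  shows "global_energy dx L T M a - global_energy dx L T M b
       = 2 * dx * (\<Sum>m\<in>M. Re (var_deriv dx L T a b m * (a m - b m)))"
proof -
  let ?w = "\<lambda>m. a m - b m"
  let ?A = "dH_fwd dx L T a b" and ?B = "dH_bwd dx L T a b"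
  have w: "fwd_diff dx a m - fwd_diff dx b m = fwd_diff dx ?w m"
          "bwd_diff dx a m - bwd_diff dx b m = bwd_diff dx ?w m" for m
    by (simp_all add: fwd_diff_def bwd_diff_def diff_divide_distrib)
  have parts: "(\<Sum>m\<in>M. ?A m * fwd_diff dx ?w m) = - (\<Sum>m\<in>M. bwd_diff dx ?A m * ?w m)"
              "(\<Sum>m\<in>M. ?B m * bwd_diff dx ?w m) = - (\<Sum>m\<in>M. fwd_diff dx ?B m * ?w m)"
    using assms(2) by (simp_all add: suitable_bc_def Let_def)
  have "(\<Sum>m\<in>M. dH dx L T a b m * ?w m + ?A m * fwd_diff dx ?w m + ?B m * bwd_diff dx ?w m)
      = (\<Sum>m\<in>M. var_deriv dx L T a b m * ?w m)"
    by (simp only: sum.distrib parts var_deriv_def left_diff_distrib sum_subtractf) simp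
  then have "(\<Sum>m\<in>M. local_energy dx L T a m - local_energy dx L T b m)
      = 2 * Re (\<Sum>m\<in>M. var_deriv dx L T a b m * ?w m)"
    by (simp only: local_energy_difference[OF assms(1)] w flip: sum_distrib_left Re_sum)
  then show ?thesis
    unfolding global_energy_def right_diff_distrib[symmetric] sum_subtractf Re_sum
    by (simp only: mult_ac)
qed

text \<open>The factor \<open>1 + cos (\<omega> dt)\<close> vanishes only at odd multiples of \<open>\<pi>\<close>, where the sine does too.\<close>

lemma ef_alpha_nonzero:
  assumes "\<omega> \<noteq> 0" "dt \<noteq> 0" "sin (\<omega> * dt) \<noteq> 0"
  shows "ef_alpha \<omega> dt \<noteq> 0"
proof -
  have "1 + cos (\<omega> * dt) \<noteq> 0"
  proof
    assume "1 + cos (\<omega> * dt) = 0"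
    then have "cos (\<omega> * dt) = - 1"
      by linarith
    then show False
      using assms(3) sin_cos_squared_add[of "\<omega> * dt"] by simp
  qed
  then show ?thesis
    using assms by (simp add: ef_alpha_def)
qed

text \<open>Multiplication by \<open>\<i>\<close> is skew-symmetric: a direction that is an imaginary multiple of the
  gradient is orthogonal to it.\<close>

lemma Re_mult_eq_0_if_imaginary_multiple_cnj:
  assumes "of_real c * w = - \<i> * cnj v" "c \<noteq> 0"
  shows "Re (v * w) = 0"
proof -
  have "c * Re (v * w) = Re (v * (of_real c * w))"
    by (simp add: algebra_simps)
  also have "\<dots> = 0"
    unfolding assms(1) by (simp add: algebra_simps)
  finally show ?thesis
    using assms(2) by simp
qed

theorem theorem1:
  fixes \<omega> dt dx :: real
    and L :: "'l set" and T :: "'l \<Rightarrow> energy_term"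
    and M :: "int set" and z :: "nat \<Rightarrow> int \<Rightarrow> complex" and n :: nat
  assumes "\<omega> \<noteq> 0" and "dt > 0" and "sin (\<omega> * dt) \<noteq> 0" and "dx > 0"
    and "finite L" and "\<And>l. l \<in> L \<Longrightarrow> valid_term (T l)"
    and "finite M"
    and "ef_dvd_step \<omega> dt dx L T M z n"
    and "suitable_bc dx L T M (z n) (z (Suc n))"
  shows "global_energy dx L T M (z (Suc n)) = global_energy dx L T M (z n)"
proof -
  let ?V = "var_deriv dx L T (z (Suc n)) (z n)"
  let ?w = "\<lambda>m. z (Suc n) m - z n m"
  have alpha: "ef_alpha \<omega> dt / dt \<noteq> 0"
    using ef_alpha_nonzero[of \<omega> dt] assms(1-3) by simp
  have "Re (?V m * ?w m) = 0" if "m \<in> M" for m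
  proof (rule Re_mult_eq_0_if_imaginary_multiple_cnj[OF _ alpha])
    show "of_real (ef_alpha \<omega> dt / dt) * ?w m = - \<i> * cnj (?V m)"
      using assms(8) that
      by (simp add: ef_dvd_step_def time_diff_def F_dvd_def var_deriv_conj_def)
  qed
  then show ?thesis
    using global_energy_difference[OF assms(6,9)] by simp
qed

end
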